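(* Let $n_0\ge 1$ be an integer and let $a_{-n_0},\dots,a_{n_0}$ be complex numbers with $a_j=\overline{a_{-j}}$ for all $j$. Let $\phi(e^{i\theta})=\sum_{n=-n_0}^{n_0}a_ne^{in\theta}$ and, for $N\ge 1$, let $T_N=T_N(\phi)$ be the $(N+1)\times(N+1)$ band Toeplitz matrix with entries $(T_N)_{k+1,l+1}=a_{k-l}$ if $|k-l|\le n_0$ and $0$ otherwise ($0\le k,l\le N$). Let $K(z)=\sum_{m=-n_0}^{n_0}a_m z^{m+n_0}$, and assume that $K$ has no root of modulus $1$, that $K$ has exactly $n_0$ roots (counted with multiplicity) of modulus $<1$ and $n_0$ roots of modulus $>1$, and that $K$ is normalized so that its leading coefficient is $1$, i.e. $K(z)=\prod_{i=1}^{\sigma}(z-\alpha_i)^{s_i}\prod_{j=1}^{\sigma}(z-\overline{\alpha_j}^{-1})^{s_j}$ where $\alpha_1,\dots,\alpha_\sigma$ are the distinct roots of $K$ of modulus $<1$, with multiplicities $s_i$, $\sum_i s_i=n_0$. Then: (i) $T_N$ is invertible; (ii) let $x\in]0,1[$ and let $k=k_N$, $l=l_N\in\{0,\dots,N\}$ satisfy $|k-l|=Nx$. Then for every real $a\in]0,1[$ and every real $\rho$ with $\max\{|\alpha_i|:1\le i\le\sigma\}<\rho<1$, one has $(T_N^{-1})_{k+1,l+1}=o(\rho^{a|k-l|})$ as $N\to\infty$. *)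

theory Defs
  imports "Jordan_Normal_Form.Matrix" "HOL-Computational_Algebra.Polynomial"
    "HOL-Library.Landau_Symbols" Complex_Main
begin

definition toeplitz_band :: "(int \<Rightarrow> complex) \<Rightarrow> nat \<Rightarrow> nat \<Rightarrow> complex mat" where
  "toeplitz_band a n0 N = mat (N+1) (N+1)
     (\<lambda>(k,l). if \<bar>int k - int l\<bar> \<le> int n0 then a (int k - int l) else 0)"

definition mat_inv :: "complex mat \<Rightarrow> complex mat" where
  "mat_inv A = (SOME B. inverts_mat A B \<and> inverts_mat B A)"

definition K_poly :: "(int \<Rightarrow> complex) \<Rightarrow> nat \<Rightarrow> complex poly" where
  "K_poly a n0 = (\<Sum>j\<le>2*n0. monom (a (int j - int n0)) j)"

definition roots_count_in :: "complex poly \<Rightarrow> complex set \<Rightarrow> nat" where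
  "roots_count_in p S = (\<Sum>z\<in>{z. poly p z = 0 \<and> z \<in> S}. order z p)"

end

theory Submission
  imports Defs "HOL-Computational_Algebra.Fundamental_Theorem_Algebra"
    "HOL-Computational_Algebra.Polynomial_FPS" "HOL-Computational_Algebra.Polynomial_Factorial"
    "HOL-Computational_Algebra.Field_as_Ring" "Jordan_Normal_Form.Determinant"
begin

text \<open>
  Since the symbol is real on the unit circle, the roots of \<open>K\<close> are symmetric about it, so
  \<open>K = c P Q\<close> where \<open>Q\<close> collects the roots inside the disc and \<open>P\<close> is its conjugate reflection.
  With \<open>b\<close> the coefficients of \<open>P\<close> and \<open>L = (b (k - m))\<close> lower triangular of size \<open>N + n0 + 1\<close>,
  the matrix \<open>T\<^sub>N\<close> is the compression of \<open>c L L\<^sup>*\<close> to the indices \<open>\<ge> n0\<close>: a vector \<open>x\<close> is padded with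
  \<open>n0\<close> leading zeros. Hence \<open>x\<^sup>* T\<^sub>N x = c \<parallel>L\<^sup>* x\<parallel>\<^sup>2\<close>, which gives invertibility.

  The coefficients \<open>g\<close> of \<open>1 / P\<close> are \<open>O(r\<^sup>n)\<close> for every \<open>r\<close> above the moduli of the inner roots.
  If \<open>T\<^sub>N x\<close> is the \<open>l\<close>-th unit vector and \<open>Y = L\<^sup>* x\<close>, the energy identity bounds \<open>x\<close> and \<open>Y\<close>
  uniformly in \<open>N\<close>. Then \<open>L Y\<close> is bounded on the \<open>n0\<close> padding indices and elsewhere supported
  at \<open>l\<close>, so inverting \<open>L\<close> and then \<open>L\<^sup>*\<close> through \<open>g\<close> yields \<open>x k = O(r\<^sup>k\<^sup>-\<^sup>l)\<close> for \<open>k \<ge> l\<close>. The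
  case \<open>k < l\<close> follows as the inverse is Hermitian.
\<close>

section \<open>Geometric bounds for the coefficients of a reciprocal polynomial\<close>

text \<open>Dividing by \<open>1 - \<beta> X\<close> turns \<open>G\<close> into the solution of
  \<open>H n = G n + \<beta> * H (n - 1)\<close>. Since \<open>norm \<beta> < r\<close> strictly,
  the rate \<open>r\<close> survives and only the constant grows.\<close>

lemma fps_inverse_linear_factor_bound:
  fixes P :: "complex poly" and G :: "complex fps"
  assumes r: "0 < r" "norm \<beta> < r" and inv: "fps_of_poly P * G = 1"
    and bound: "\<And>n. norm (fps_nth G n) \<le> C * r ^ n"
  shows "\<exists>G' C'. fps_of_poly ([:1, -\<beta>:] * P) * G' = 1 \<and> (\<forall>n. norm (fps_nth G' n) \<le> C' * r ^ n)"
proof -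
  define D where "D = (1 - fps_const \<beta> * fps_X :: complex fps)"
  have D: "fps_of_poly [:1, -\<beta>:] = D"
    by (simp add: D_def fps_of_poly_pCons)
  have D0: "D * inverse D = 1"
    by (rule inverse_mult_eq_1') (simp add: D_def)
  define H where "H = G * inverse D"
  have "H * D = G"
    using D0 by (simp add: H_def mult.assoc mult.commute[of "inverse D"])
  hence "H = G + fps_const \<beta> * (fps_X * H)"
    by (simp add: D_def algebra_simps)
  hence "fps_nth H n = fps_nth (G + fps_const \<beta> * (fps_X * H)) n" for n
    by simp
  hence rec: "fps_nth H n = fps_nth G n + \<beta> * (if n = 0 then 0 else fps_nth H (n - 1))" for n
    by simp
  \<comment> \<open>The value solving \<open>C * r + norm \<beta> * C' = C' * r\<close>, which is
    what makes the induction close.\<close>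
  define C' where "C' = C * r / (r - norm \<beta>)"
  have "0 \<le> C"
    using bound[of 0] norm_ge_zero[of "fps_nth G 0"] by (simp del: norm_ge_zero)
  have C': "C * r + norm \<beta> * C' = C' * r"
    using r by (simp add: C'_def field_simps)
  have "C \<le> C'"
    using r \<open>0 \<le> C\<close> by (simp add: C'_def field_simps mult_left_mono)
  have "norm (fps_nth H n) \<le> C' * r ^ n" for n
  proof (induction n)
    case 0
    show ?case using bound[of 0] rec[of 0] \<open>C \<le> C'\<close> by simp
  next
    case (Suc n)
    have "norm (fps_nth H (Suc n)) \<le> norm (fps_nth G (Suc n)) + norm \<beta> * norm (fps_nth H n)"
      using norm_triangle_ineq[of "fps_nth G (Suc n)" "\<beta> * fps_nth H n"]
      by (simp add: rec[of "Suc n"] norm_mult)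
    also have "\<dots> \<le> C * r ^ Suc n + norm \<beta> * (C' * r ^ n)"
      by (intro add_mono bound mult_left_mono Suc.IH) auto
    also have "\<dots> = (C * r + norm \<beta> * C') * r ^ n"
      by (simp add: algebra_simps)
    finally show ?case by (simp add: C' mult.assoc)
  qed
  moreover have "fps_of_poly ([:1, -\<beta>:] * P) * H = (fps_of_poly P * G) * (D * inverse D)"
    by (simp only: fps_of_poly_mult D H_def mult_ac)
  ultimately show ?thesis
    using inv D0 by auto
qed

text \<open>One linear factor is inverted at a time: an outer induction over the roots, an inner one
  over the multiplicity. The gap between the moduli and \<open>r\<close> absorbs the polynomial
  growth caused by multiple roots.\<close>

lemma fps_inverse_prod_linear_bound:
  fixes A :: "complex set" and r :: real
  assumes "finite A" and "0 < r" and "\<And>z. z \<in> A \<Longrightarrow> norm z < r"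
  shows "\<exists>G C. fps_of_poly (\<Prod>z\<in>A. [:1, -cnj z:] ^ e z) * G = 1 \<and>
           (\<forall>n. norm (fps_nth G n) \<le> C * r ^ n)"
  using assms(1,3)
proof (induction A rule: finite_induct)
  case empty
  have "norm (fps_nth (1 :: complex fps) n) \<le> 1 * r ^ n" for n
    using \<open>0 < r\<close> by (cases n) auto
  moreover have "fps_of_poly (\<Prod>z\<in>{}. [:1, -cnj z:] ^ e z) * 1 = 1"
    by simp
  ultimately show ?case by blast
next
  case (insert w A)
  have "\<exists>G C. fps_of_poly ([:1, -cnj w:] ^ m * (\<Prod>z\<in>A. [:1, -cnj z:] ^ e z)) * G = 1 \<and>
           (\<forall>n. norm (fps_nth G n) \<le> C * r ^ n)" for m
  proof (induction m)
    case 0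
    show ?case using insert by simp
  next
    case (Suc m)
    then obtain G C where "fps_of_poly ([:1, -cnj w:] ^ m * (\<Prod>z\<in>A. [:1, -cnj z:] ^ e z)) * G = 1"
      and "\<And>n. norm (fps_nth G n) \<le> C * r ^ n" by blast
    from fps_inverse_linear_factor_bound[OF \<open>0 < r\<close> _ this, of "cnj w"] insert.prems
    show ?case by (simp only: power_Suc mult.assoc) (simp del: mult_pCons_left)
  qed
  then show ?case using insert by simp
qed

section \<open>Triangular Toeplitz operators, their energy identity and their inverses\<close>

text \<open>Application of \<open>L\<close>. Row \<open>k\<close> involves only entries up to
  \<open>k\<close>, so no matrix size is needed; the adjoint \<open>upper_act\<close> needs the
  cut-off \<open>M\<close>.\<close>

definition lower_act :: "(nat \<Rightarrow> complex) \<Rightarrow> (nat \<Rightarrow> complex) \<Rightarrow> nat \<Rightarrow> complex" where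
  "lower_act b y k = (\<Sum>m\<le>k. b (k - m) * y m)"

definition upper_act :: "(nat \<Rightarrow> complex) \<Rightarrow> nat \<Rightarrow> (nat \<Rightarrow> complex) \<Rightarrow> nat \<Rightarrow> complex" where
  "upper_act b M x m = (\<Sum>j=m..M. cnj (b (j - m)) * x j)"

lemma sum_upper_triangle_swap:
  "(\<Sum>m=k..M. \<Sum>j=m..M. f m j) = (\<Sum>j=k..M. \<Sum>m=k..j. f m j)"
  for k M :: nat and f :: "nat \<Rightarrow> nat \<Rightarrow> 'a :: comm_monoid_add"
proof -
  have "(\<Sum>m=k..M. \<Sum>j=m..M. f m j) = (\<Sum>m\<in>{k..M}. \<Sum>j\<in>{j\<in>{k..M}. m \<le> j}. f m j)"
    by (intro sum.cong) auto
  also have "\<dots> = (\<Sum>j\<in>{k..M}. \<Sum>m\<in>{m\<in>{k..M}. m \<le> j}. f m j)"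
    by (rule sum.swap_restrict) auto
  also have "\<dots> = (\<Sum>j=k..M. \<Sum>m=k..j. f m j)"
    by (intro sum.cong) auto
  finally show ?thesis .
qed

text \<open>On the indices \<open>0..M\<close> the two operators are adjoint, so pairing
  \<open>x\<close> with the image of \<open>x\<close> under \<open>L\<close> times its adjoint gives
  a squared norm.\<close>

lemma upper_act_energy:
  "(\<Sum>k\<le>M. cnj (x k) * lower_act b (upper_act b M x) k) =
     complex_of_real (\<Sum>m\<le>M. (norm (upper_act b M x m))\<^sup>2)"
proof -
  let ?Y = "upper_act b M x"
  have "(\<Sum>k\<le>M. cnj (x k) * lower_act b ?Y k) = (\<Sum>k=0..M. \<Sum>m=0..k. cnj (x k) * b (k - m) * ?Y m)"
    by (simp add: lower_act_def sum_distrib_left mult.assoc atMost_atLeast0)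
  also have "\<dots> = (\<Sum>m=0..M. \<Sum>k=m..M. cnj (x k) * b (k - m) * ?Y m)"
    by (rule sum_upper_triangle_swap[symmetric])
  also have "\<dots> = (\<Sum>m=0..M. ?Y m * cnj (?Y m))"
    by (rule sum.cong) (auto simp: upper_act_def[of b M x] sum_distrib_right sum_distrib_left mult_ac intro!: sum.cong)
  finally show ?thesis
    by (simp only: complex_norm_square atMost_atLeast0 of_real_sum)
qed

text \<open>The generating functions of \<open>b\<close> and \<open>g\<close> are mutually
  reciprocal. Decay of \<open>g\<close> is left out, so that the algebra can be combined with any
  rate \<open>r\<close>.\<close>

locale convolution_inverse =
  fixes b g :: "nat \<Rightarrow> complex"
  assumes conv: "(\<Sum>i\<le>n. b (n - i) * g i) = (if n = 0 then 1 else 0)"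
begin

lemma conv_shift:
  assumes "k \<le> j"
  shows "(\<Sum>m=k..j. b (j - m) * g (m - k)) = (if j = k then 1 else 0)"
proof -
  have "(\<Sum>m=k..j. b (j - m) * g (m - k)) = (\<Sum>i\<le>j-k. b (j - k - i) * g i)"
    using assms
    by (intro sum.reindex_bij_witness[of _ "\<lambda>i. i + k" "\<lambda>m. m - k"]) auto
  also have "\<dots> = (if j = k then 1 else 0)"
    unfolding conv using assms by auto
  finally show ?thesis .
qed

lemma conv_shift':
  assumes "k \<le> j"
  shows "(\<Sum>m=k..j. g (j - m) * b (m - k)) = (if j = k then 1 else 0)"
proof -
  have "(\<Sum>m=k..j. g (j - m) * b (m - k)) = (\<Sum>m=k..j. b (j - m) * g (m - k))"
    using assms
    by (intro sum.reindex_bij_witness[of _ "\<lambda>m. j + k - m" "\<lambda>m. j + k - m"])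
       (auto simp: mult.commute)
  thus ?thesis by (simp add: conv_shift[OF assms])
qed

text \<open>The adjoint of the triangular Toeplitz matrix of \<open>g\<close> inverts the adjoint of
  \<open>L\<close>. Truncation at \<open>M\<close> is harmless, since entry \<open>k\<close> of
  either product uses only indices in \<open>k..M\<close>.\<close>

lemma upper_act_inverse:
  assumes "k \<le> M"
  shows "x k = (\<Sum>m=k..M. cnj (g (m - k)) * upper_act b M x m)"
proof -
  have "(\<Sum>m=k..M. cnj (g (m - k)) * upper_act b M x m) =
      (\<Sum>m=k..M. \<Sum>j=m..M. cnj (b (j - m) * g (m - k)) * x j)"
    by (simp add: upper_act_def sum_distrib_left mult_ac)
  also have "\<dots> = (\<Sum>j=k..M. \<Sum>m=k..j. cnj (b (j - m) * g (m - k)) * x j)"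
    by (rule sum_upper_triangle_swap)
  also have "\<dots> = (\<Sum>j=k..M. cnj (\<Sum>m=k..j. b (j - m) * g (m - k)) * x j)"
    by (simp add: sum_distrib_right)
  also have "\<dots> = (\<Sum>j=k..M. if j = k then x j else 0)"
    by (intro sum.cong) (auto simp: conv_shift)
  finally show ?thesis using assms by simp
qed

lemma lower_act_inverse:
  "y m = (\<Sum>k\<le>m. g (m - k) * lower_act b y k)"
proof -
  have "(\<Sum>k\<le>m. g (m - k) * lower_act b y k) =
      (\<Sum>k=0..m. \<Sum>j=0..k. g (m - k) * b (k - j) * y j)"
    by (simp add: lower_act_def sum_distrib_left mult.assoc atMost_atLeast0)
  also have "\<dots> = (\<Sum>j=0..m. \<Sum>k=j..m. g (m - k) * b (k - j) * y j)"
    by (rule sum_upper_triangle_swap[symmetric])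
  also have "\<dots> = (\<Sum>j=0..m. (\<Sum>k=j..m. g (m - k) * b (k - j)) * y j)"
    by (simp add: sum_distrib_right)
  also have "\<dots> = (\<Sum>j=0..m. if j = m then y j else 0)"
    by (intro sum.cong) (auto simp: conv_shift')
  finally show ?thesis by simp
qed

end

section \<open>Decay of solutions whose right-hand side is a unit vector\<close>

lemma sum_shifted_geometric_le:
  fixes r :: real
  assumes "0 < r" "r < 1"
  shows "(\<Sum>m=k..M. r ^ (m - k)) \<le> 1 / (1 - r)"
proof (cases "k \<le> M")
  case True
  have "(\<Sum>m=k..M. r ^ (m - k)) = (\<Sum>i<Suc (M - k). r ^ i)"
    using True by (intro sum.reindex_bij_witness[of _ "\<lambda>i. i + k" "\<lambda>m. m - k"]) auto
  also have "\<dots> = (1 - r ^ Suc (M - k)) / (1 - r)"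
    using assms by (subst sum_gp_strict) auto
  also have "\<dots> \<le> 1 / (1 - r)"
    using assms by (intro divide_right_mono) auto
  finally show ?thesis .
qed (use assms in auto)

context convolution_inverse
begin

text \<open>Recovering \<open>x k\<close> uses the image only at indices \<open>m \<ge> k\<close>,
  with geometrically summable weights. Hence decay of the image beyond \<open>k\<close> passes to
  \<open>x k\<close>.\<close>

lemma norm_le_of_upper_act_le:
  assumes g: "\<And>n. norm (g n) \<le> C * r ^ n" and r: "0 < r" "r < 1" and k: "k \<le> M"
    and Y: "\<And>m. k \<le> m \<Longrightarrow> m \<le> M \<Longrightarrow> norm (upper_act b M x m) \<le> s" and "0 \<le> s"
  shows "norm (x k) \<le> C / (1 - r) * s"
proof -
  have "0 \<le> C" using g[of 0] norm_ge_zero[of "g 0"] by (simp del: norm_ge_zero)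
  have "norm (x k) \<le> (\<Sum>m=k..M. norm (cnj (g (m - k)) * upper_act b M x m))"
    by (subst upper_act_inverse[OF k]) (rule norm_sum)
  also have "\<dots> \<le> (\<Sum>m=k..M. (C * r ^ (m - k)) * s)"
    using r \<open>0 \<le> C\<close> by (intro sum_mono) (auto simp: norm_mult intro!: mult_mono g Y)
  also have "\<dots> = C * s * (\<Sum>m=k..M. r ^ (m - k))"
    by (simp add: sum_distrib_left mult_ac)
  also have "\<dots> \<le> C * s * (1 / (1 - r))"
    using \<open>0 \<le> C\<close> \<open>0 \<le> s\<close> by (intro mult_left_mono sum_shifted_geometric_le r) auto
  finally show ?thesis by (simp add: field_simps)
qed

text \<open>\<open>D\<close> is chosen before \<open>M\<close>, so the estimate is uniform in the
  matrix size. The equation is silent on the padding rows \<open>j < n0\<close>; there the energy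
  identity supplies a bound.\<close>

lemma unit_solution_decay:
  assumes g: "\<And>n. norm (g n) \<le> C * r ^ n" and r: "0 < r" "r < 1" and c: "c \<noteq> 0"
  shows "\<exists>D. \<forall>M x l k. (\<forall>j<n0. x j = 0) \<longrightarrow> n0 \<le> l \<longrightarrow> l \<le> k \<longrightarrow> k \<le> M \<longrightarrow>
     (\<forall>j\<in>{n0..M}. c * lower_act b (upper_act b M x) j = (if j = l then 1 else 0)) \<longrightarrow>
     norm (x k) \<le> D * r ^ (k - l)"
proof -
  define G where "G = C / (1 - r)"
  define B where "B = (\<Sum>i\<le>n0. norm (b i))"
  \<comment> \<open>Adds the \<open>n0\<close> padding rows, each at most
    \<open>B * (G / norm c)\<close>, to the single entry \<open>1 / c\<close> in row
    \<open>l\<close>.\<close>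
  define D1 where "D1 = C * (real n0 * (B * (G / norm c)) + 1 / norm c)"
  have C: "0 \<le> C" using g[of 0] norm_ge_zero[of "g 0"] by (simp del: norm_ge_zero)
  have G: "0 \<le> G" using C r by (simp add: G_def)
  have B: "0 \<le> B" by (simp add: B_def sum_nonneg)
  have D1: "0 \<le> D1" using B C G by (simp add: D1_def)
  have "norm (x k) \<le> (G * D1) * r ^ (k - l)"
    if x0: "\<forall>j<n0. x j = 0" and l: "n0 \<le> l" "l \<le> k" "k \<le> M"
      and eq: "\<forall>j\<in>{n0..M}. c * lower_act b (upper_act b M x) j = (if j = l then 1 else 0)"
    for M x l k
  proof -
    define Y where "Y = upper_act b M x"
    define F where "F = lower_act b Y"
    have F: "F j = (if j = l then 1 / c else 0)" if "n0 \<le> j" "j \<le> M" for j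
      using eq that c by (auto simp: F_def Y_def field_simps split: if_splits)
    \<comment> \<open>\<open>x\<close> vanishes on the padding and \<open>F\<close> vanishes on the
      remaining rows other than \<open>l\<close>, so the unknown values of \<open>F\<close> below
      \<open>n0\<close> drop out.\<close>
    have "(\<Sum>j\<le>M. cnj (x j) * F j) = (\<Sum>j\<le>M. if j = l then cnj (x l) / c else 0)"
      by (rule sum.cong) (use x0 F l in \<open>auto simp: not_le[symmetric]\<close>, metis F not_le x0)
    hence "complex_of_real (\<Sum>m\<le>M. (norm (Y m))\<^sup>2) = cnj (x l) / c"
      using upper_act_energy[of x b M] l by (simp add: Y_def F_def)
    hence "norm (complex_of_real (\<Sum>m\<le>M. (norm (Y m))\<^sup>2)) = norm (x l) / norm c"
      by (simp add: norm_divide)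
    hence energy: "(\<Sum>m\<le>M. (norm (Y m))\<^sup>2) = norm (x l) / norm c"
      by (simp only: norm_of_real) (simp add: sum_nonneg)
    define s where "s = sqrt (norm (x l) / norm c)"
    have s0: "0 \<le> s" by (simp add: s_def)
    have Ys: "norm (Y m) \<le> s" if "m \<le> M" for m
    proof -
      have "(norm (Y m))\<^sup>2 \<le> (\<Sum>m\<le>M. (norm (Y m))\<^sup>2)"
        using that by (intro member_le_sum) auto
      thus ?thesis unfolding s_def energy by (rule real_le_rsqrt)
    qed
    have "norm (x l) \<le> G * s"
      unfolding G_def using l s0 Ys
      by (intro norm_le_of_upper_act_le[OF g r, of l M x s]) (auto simp: Y_def)
    moreover have "s * s = norm (x l) / norm c"
      by (simp add: s_def)
    \<comment> \<open>The energy bounds itself: \<open>s * s\<close> equals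
      \<open>norm (x l) / norm c\<close>, and \<open>norm (x l)\<close> is in turn linear in
      \<open>s\<close>. Cancelling \<open>s\<close> leaves a bound free of \<open>M\<close>.\<close>
    ultimately have "s * s \<le> G / norm c * s"
      using c by (simp add: field_simps)
    hence sG: "s \<le> G / norm c"
      using s0 G by (cases "s = 0") (simp_all only: mult_le_cancel_right, auto)
    have YG: "norm (Y m) \<le> G / norm c" if "m \<le> M" for m
      using Ys[OF that] sG by simp
    have Fsmall: "norm (F j) \<le> B * (G / norm c)" if "j < n0" for j
    proof -
      have "norm (F j) \<le> (\<Sum>m\<le>j. norm (b (j - m) * Y m))"
        unfolding F_def lower_act_def by (rule norm_sum)
      also have "\<dots> \<le> (\<Sum>m\<le>j. norm (b (j - m)) * (G / norm c))"
        using that l by (intro sum_mono) (auto simp only: norm_mult atMost_iff intro!: mult_left_mono YG norm_ge_zero)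
      also have "\<dots> = (\<Sum>i\<le>j. norm (b i)) * (G / norm c)"
        unfolding sum_distrib_right[symmetric]
        by (intro arg_cong2[where f = "(*)"] refl sum.reindex_bij_witness[of _ "\<lambda>i. j - i" "\<lambda>i. j - i"]) auto
      also have "\<dots> \<le> B * (G / norm c)"
        unfolding B_def using that G by (intro mult_right_mono sum_mono2) auto
      finally show ?thesis .
    qed
    \<comment> \<open>Only \<open>j < n0\<close> and \<open>j = l\<close> contribute to the
      inversion formula. As \<open>n0 \<le> l\<close>, padding rows lie farther from
      \<open>m\<close> than \<open>l\<close> does, so their weights are also at most
      \<open>C * r ^ (m - l)\<close>.\<close>
    have Ydecay: "norm (Y m) \<le> D1 * r ^ (m - l)" if m: "l \<le> m" "m \<le> M" for m
    proof -
      have "norm (Y m) \<le> (\<Sum>j\<le>m. norm (g (m - j) * F j))"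
        by (subst lower_act_inverse[of Y m]) (simp add: F_def norm_sum)
      also have "\<dots> \<le> (\<Sum>j\<le>m. (if j < n0 then C * r ^ (m - l) * (B * (G / norm c)) else 0)
                           + (if j = l then C * r ^ (m - l) * (1 / norm c) else 0))"
      proof (rule sum_mono)
        fix j assume j: "j \<in> {..m}"
        show "norm (g (m - j) * F j) \<le> (if j < n0 then C * r ^ (m - l) * (B * (G / norm c)) else 0)
                           + (if j = l then C * r ^ (m - l) * (1 / norm c) else 0)"
        proof (cases "j < n0")
          case True
          have "norm (g (m - j)) \<le> C * r ^ (m - j)" by (rule g)
          also have "\<dots> \<le> C * r ^ (m - l)"
            using C r True l by (intro mult_left_mono power_decreasing) auto
          finally have "norm (g (m - j)) * norm (F j) \<le> C * r ^ (m - l) * (B * (G / norm c))"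
            using Fsmall[OF True] C r by (intro mult_mono) auto
          thus ?thesis using True l by (simp add: norm_mult)
        next
          case False
          thus ?thesis using F[of j] j m g[of "m - l"] by (auto simp: norm_mult norm_divide divide_right_mono)
        qed
      qed
      also have "\<dots> = (\<Sum>j\<in>{j\<in>{..m}. j < n0}. C * r ^ (m - l) * (B * (G / norm c)))
           + C * r ^ (m - l) * (1 / norm c)"
        using m unfolding sum.distrib sum.inter_filter[OF finite_atMost] by (simp add: sum.delta)
      also have "{j\<in>{..m}. j < n0} = {..<n0}"
        using m l by auto
      also have "(\<Sum>j<n0. C * r ^ (m - l) * (B * (G / norm c))) + C * r ^ (m - l) * (1 / norm c)
          = D1 * r ^ (m - l)"
        by (simp add: D1_def algebra_simps)
      finally show ?thesis .
    qed
    have "norm (x k) \<le> C / (1 - r) * (D1 * r ^ (k - l))"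
    proof (rule norm_le_of_upper_act_le[OF g r \<open>k \<le> M\<close>])
      fix m assume m: "k \<le> m" "m \<le> M"
      have "norm (upper_act b M x m) \<le> D1 * r ^ (m - l)"
        using Ydecay[of m] m l by (simp add: Y_def)
      also have "\<dots> \<le> D1 * r ^ (k - l)"
        using D1 r m by (intro mult_left_mono power_decreasing) auto
      finally show "norm (upper_act b M x m) \<le> D1 * r ^ (k - l)" .
    qed (use D1 r in auto)
    thus ?thesis by (simp add: G_def mult.assoc)
  qed
  thus ?thesis by blast
qed

end

section \<open>Spectral factorization of the symbol polynomial\<close>

lemma coprime_complex_polyI:
  fixes p q :: "complex poly"
  assumes "p \<noteq> 0" and "\<And>z. poly p z = 0 \<Longrightarrow> poly q z \<noteq> 0"
  shows "coprime p q"
proof (rule coprimeI)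
  fix d assume d: "d dvd p" "d dvd q"
  with \<open>p \<noteq> 0\<close> have "d \<noteq> 0" by auto
  have "poly d z \<noteq> 0" for z
    using assms(2)[of z] d by (auto elim!: dvdE)
  hence "constant (poly d)"
    using fundamental_theorem_of_algebra by blast
  hence "degree d = 0"
    by (simp add: constant_degree)
  with \<open>d \<noteq> 0\<close> show "d dvd 1"
    by (simp add: is_unit_iff_degree)
qed

lemma map_poly_cnj_mult: "map_poly cnj (p * q) = map_poly cnj p * map_poly cnj q"
  by (rule poly_ext) simp

lemma coeff_K_poly: "coeff (K_poly a n0) j = (if j \<le> 2 * n0 then a (int j - int n0) else 0)"
  by (simp add: K_poly_def coeff_sum)

text \<open>Conjugate symmetry of the symbol says that the coefficients read backwards are the
  conjugates. The degree assumption makes the reflection take place about index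
  \<open>n0\<close>.\<close>

lemma K_poly_self_reciprocal:
  assumes herm: "\<And>j. \<bar>j\<bar> \<le> int n0 \<Longrightarrow> a j = cnj (a (- j))"
    and deg: "degree (K_poly a n0) = 2 * n0"
  shows "reflect_poly (map_poly cnj (K_poly a n0)) = K_poly a n0"
proof (rule poly_eqI)
  fix j
  have "a (int j - int n0) = cnj (a (int n0 - int j))" if "j \<le> 2 * n0"
    using herm[of "int j - int n0"] that by simp
  moreover have "degree (map_poly cnj (K_poly a n0)) = 2 * n0"
    using deg by (simp add: degree_map_poly)
  ultimately show "coeff (reflect_poly (map_poly cnj (K_poly a n0))) j = coeff (K_poly a n0) j"
    by (auto simp: coeff_reflect_poly coeff_map_poly coeff_K_poly of_nat_diff)
qed

lemma degree_prod_root_powers: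
  "finite A \<Longrightarrow> degree (\<Prod>z\<in>A. [:-z, 1:] ^ e z) = (\<Sum>z\<in>A. e z)" for A :: "complex set"
  by (subst degree_prod_sum_eq) (auto simp: degree_power_eq)

text \<open>Write \<open>K = Q * R\<close> with the outer roots in \<open>R\<close>.
  Self-reciprocity gives \<open>P dvd K\<close>; \<open>P\<close> has no root in the open disc, so
  it is coprime to \<open>Q\<close> and divides \<open>R\<close>; equal degrees leave a constant.
  This avoids matching reflected roots and multiplicities one by one.\<close>

lemma K_poly_spectral_factorization:
  fixes a :: "int \<Rightarrow> complex" and n0 :: nat
  defines "K \<equiv> K_poly a n0"
  defines "Q \<equiv> \<Prod>z | poly K z = 0 \<and> norm z < 1. [:-z, 1:] ^ order z K"
  defines "P \<equiv> \<Prod>z | poly K z = 0 \<and> norm z < 1. [:1, -cnj z:] ^ order z K"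
  assumes herm: "\<And>j. \<bar>j\<bar> \<le> int n0 \<Longrightarrow> a j = cnj (a (- j))"
    and no_unit_root: "\<And>z. poly K z = 0 \<Longrightarrow> norm z \<noteq> 1"
    and inside: "roots_count_in K {z. norm z < 1} = n0"
    and outside: "roots_count_in K {z. norm z > 1} = n0"
    and monic: "lead_coeff K = 1"
  shows "P = reflect_poly (map_poly cnj Q)" and "degree Q = n0" and "degree P = n0"
    and "\<exists>c. c \<noteq> 0 \<and> K = smult c (P * Q)"
proof -
  define R where "R = (\<Prod>z | poly K z = 0 \<and> norm z > 1. [:-z, 1:] ^ order z K)"
  have "K \<noteq> 0" using monic by auto
  hence fin: "finite {z. poly K z = 0}" by (rule poly_roots_finite)
  have fin1: "finite {z. poly K z = 0 \<and> norm z < 1}" and fin2: "finite {z. poly K z = 0 \<and> norm z > 1}"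
    using fin by auto
  have un: "{z. poly K z = 0} = {z. poly K z = 0 \<and> norm z < 1} \<union> {z. poly K z = 0 \<and> norm z > 1}"
    using no_unit_root by (auto simp: neq_iff)
  have KQR: "K = Q * R"
    using complex_poly_decompose[of K] monic
    unfolding Q_def R_def by (subst prod.union_disjoint[symmetric]) (use fin1 fin2 un in auto)
  show degQ: "degree Q = n0"
    using inside unfolding Q_def roots_count_in_def by (subst degree_prod_root_powers[OF fin1]) simp
  have degR: "degree R = n0"
    using outside unfolding R_def roots_count_in_def by (subst degree_prod_root_powers[OF fin2]) simp
  have nz: "Q \<noteq> 0" "R \<noteq> 0" using \<open>K \<noteq> 0\<close> KQR by auto
  have degK: "degree K = 2 * n0"
    using nz by (simp add: KQR degree_mult_eq degQ degR)
  have recip: "reflect_poly (map_poly cnj K) = K"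
    unfolding K_def by (rule K_poly_self_reciprocal, erule herm, rule degK[unfolded K_def])
  have "map_poly cnj Q = (\<Prod>z | poly K z = 0 \<and> norm z < 1. [:-cnj z, 1:] ^ order z K)"
    unfolding Q_def by (rule poly_ext) (simp add: poly_prod)
  moreover have "reflect_poly [:-cnj z, 1:] = [:1, -cnj z:]" for z
    by (cases "z = 0") (simp_all add: reflect_poly_def cCons_def)
  ultimately show P: "P = reflect_poly (map_poly cnj Q)"
    by (simp add: P_def reflect_poly_prod reflect_poly_power)
  \<comment> \<open>Excludes the root 0, for which the factor \<open>[:1, -cnj z:]\<close> would
    have degree 0 and \<open>P\<close> would lose degree.\<close>
  have "coeff K 0 = cnj (lead_coeff K)"
    using herm[of "- int n0"] degK by (simp add: K_def coeff_K_poly)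
  hence K0: "poly K 0 \<noteq> 0" using monic by (simp add: poly_0_coeff_0)
  hence "coeff Q 0 \<noteq> 0" by (simp add: KQR flip: poly_0_coeff_0)
  hence "coeff (map_poly cnj Q) 0 \<noteq> 0" by (simp add: coeff_map_poly)
  hence degP: "degree P = degree (map_poly cnj Q)"
    unfolding P by (rule degree_reflect_poly_eq)
  also have "\<dots> = n0" by (simp add: degree_map_poly degQ)
  finally show degP: "degree P = n0" .
  \<comment> \<open>Conjugating and reflecting \<open>K = Q * R\<close> gives \<open>K\<close>
    again, with \<open>P\<close> as the image of \<open>Q\<close>.\<close>
  have "P dvd K"
    using recip by (metis KQR P dvd_triv_left map_poly_cnj_mult reflect_poly_mult)
  moreover have "coprime Q P"
  proof (rule coprime_complex_polyI[OF nz(1)])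
    fix z assume "poly Q z = 0"
    hence z: "norm z < 1"
      unfolding Q_def using fin1 by (auto simp: poly_prod)
    have "1 \<noteq> z * cnj w" if "norm w < 1" for w
    proof
      assume "1 = z * cnj w"
      hence "norm z * norm w = 1"
        by (metis complex_mod_cnj norm_mult norm_one)
      moreover have "norm z * norm w < 1 * 1"
        using z that by (intro mult_strict_mono') auto
      ultimately show False by simp
    qed
    thus "poly P z \<noteq> 0"
      unfolding P_def using fin1 by (auto simp: poly_prod)
  qed
  ultimately have "P dvd R"
    using KQR coprime_commute coprime_dvd_mult_right_iff by metis
  then obtain S where S: "R = P * S" by (elim dvdE)
  have "P \<noteq> 0" "S \<noteq> 0" using nz S by auto
  hence "degree S = 0" using degR degP S by (simp add: degree_mult_eq)
  then obtain c where c: "S = [:c:]" by (elim degree_eq_zeroE)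
  hence "c \<noteq> 0" "K = smult c (P * Q)"
    using \<open>S \<noteq> 0\<close> KQR S by (auto simp: mult_ac)
  thus "\<exists>c. c \<noteq> 0 \<and> K = smult c (P * Q)" by blast
qed

section \<open>The Toeplitz matrix as a compressed triangular product\<close>

text \<open>Conjugated coefficients of \<open>P\<close> are those of \<open>Q\<close> in reverse, so
  the correlation of two rows is a convolution coefficient of \<open>P * Q\<close>. Row indices of
  at least \<open>n\<close> ensure that the sum is not cut short at \<open>m = 0\<close>; this is
  why the padding is needed.\<close>

lemma coeff_mult_reflect_cnj:
  fixes P Q :: "complex poly" and k l n :: nat
  assumes P: "P = reflect_poly (map_poly cnj Q)" and deg: "degree Q = n" "degree P = n"
    and kl: "n \<le> k" "n \<le> l"
  shows "(\<Sum>m\<le>min k l. coeff P (k - m) * cnj (coeff P (l - m))) =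
     (if l \<le> n + k then coeff (P * Q) (n + k - l) else 0)"
proof -
  have Q: "coeff Q s = (if s \<le> n then cnj (coeff P (n - s)) else 0)" for s
    using deg by (auto simp: P coeff_reflect_poly coeff_map_poly degree_map_poly coeff_eq_0)
  have b0: "coeff P i = 0" if "n < i" for i
    using that deg by (simp add: coeff_eq_0)
  consider "l \<le> k" | "k < l" "l \<le> n + k" | "n + k < l" by linarith
  thus ?thesis
  proof cases
    case 1
    have "(\<Sum>m\<le>min k l. coeff P (k - m) * cnj (coeff P (l - m))) =
        (\<Sum>i=k-l..k. coeff P i * cnj (coeff P (i - (k - l))))"
      using 1 by (intro sum.reindex_bij_witness[of _ "\<lambda>i. k - i" "\<lambda>m. k - m"]) auto
    \<comment> \<open>The ranges differ only by zero terms: \<open>coeff Q\<close> vanishes beyond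
      \<open>n\<close> when \<open>i < k - l\<close>, and \<open>coeff P (i - (k - l))\<close>
      vanishes when \<open>i > n + k - l\<close>.\<close>
    also have "\<dots> = (\<Sum>i\<le>n+k-l. coeff P i * coeff Q (n + k - l - i))"
      using 1 kl by (intro sum.mono_neutral_cong) (auto simp: Q b0 add.commute)
    finally show ?thesis using 1 by (simp add: coeff_mult)
  next
    case 2
    have "(\<Sum>m\<le>min k l. coeff P (k - m) * cnj (coeff P (l - m))) =
        (\<Sum>i\<le>k. coeff P i * cnj (coeff P (i + (l - k))))"
      using 2 by (intro sum.reindex_bij_witness[of _ "\<lambda>i. k - i" "\<lambda>m. k - m"]) auto
    also have "\<dots> = (\<Sum>i\<le>n+k-l. coeff P i * coeff Q (n + k - l - i))"
      using 2 kl by (intro sum.mono_neutral_cong) (auto simp: Q b0 add.commute)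
    finally show ?thesis using 2 by (simp add: coeff_mult)
  next
    case 3
    thus ?thesis by (auto intro!: sum.neutral simp: b0)
  qed
qed

lemma toeplitz_band_factorization:
  fixes a :: "int \<Rightarrow> complex" and n0 :: nat
  defines "K \<equiv> K_poly a n0"
  assumes K: "K = smult c (P * Q)" and P: "P = reflect_poly (map_poly cnj Q)"
    and deg: "degree Q = n0" "degree P = n0" and kl: "k \<le> N" "l \<le> N"
  shows "toeplitz_band a n0 N $$ (k, l) =
    c * (\<Sum>m\<le>min (k + n0) (l + n0). coeff P (k + n0 - m) * cnj (coeff P (l + n0 - m)))"
proof -
  have "c * (\<Sum>m\<le>min (k + n0) (l + n0). coeff P (k + n0 - m) * cnj (coeff P (l + n0 - m))) =
      (if l \<le> n0 + k then coeff K (n0 + k - l) else 0)"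
    by (subst coeff_mult_reflect_cnj[OF P deg]) (auto simp: K add.commute)
  also have "\<dots> = (if \<bar>int k - int l\<bar> \<le> int n0 then a (int k - int l) else 0)"
    by (auto simp: K_def coeff_K_poly of_nat_diff)
  finally show ?thesis
    using kl by (simp add: toeplitz_band_def)
qed

lemma lower_upper_act:
  assumes "k \<le> M"
  shows "lower_act b (upper_act b M x) k =
     (\<Sum>j\<le>M. (\<Sum>m\<le>min k j. b (k - m) * cnj (b (j - m))) * x j)"
proof -
  have "lower_act b (upper_act b M x) k =
      (\<Sum>m\<in>{..k}. \<Sum>j\<in>{j\<in>{..M}. m \<le> j}. b (k - m) * cnj (b (j - m)) * x j)"
    unfolding lower_act_def upper_act_def sum_distrib_left mult.assoc
    by (intro sum.cong) auto
  also have "\<dots> = (\<Sum>j\<in>{..M}. \<Sum>m\<in>{m\<in>{..k}. m \<le> j}. b (k - m) * cnj (b (j - m)) * x j)"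
    by (rule sum.swap_restrict) auto
  also have "\<dots> = (\<Sum>j\<le>M. \<Sum>m\<le>min k j. b (k - m) * cnj (b (j - m)) * x j)"
    by (intro sum.cong) auto
  finally show ?thesis by (simp add: sum_distrib_right)
qed

text \<open>With \<open>n0\<close> leading zeros in the vector, the first \<open>n0\<close> columns
  of the larger product contribute nothing, and its rows from \<open>n0\<close> on reproduce
  \<open>A\<close>.\<close>

lemma mult_mat_vec_eq_lower_upper_act:
  assumes A: "A \<in> carrier_mat (N + 1) (N + 1)" and v: "v \<in> carrier_vec (N + 1)" and k: "k \<le> N"
    and entry: "\<And>k l. k \<le> N \<Longrightarrow> l \<le> N \<Longrightarrow> A $$ (k, l) =
       c * (\<Sum>m\<le>min (k + n0) (l + n0). b (k + n0 - m) * cnj (b (l + n0 - m)))"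
  shows "(A *\<^sub>v v) $ k =
    c * lower_act b (upper_act b (N + n0) (\<lambda>j. if j < n0 then 0 else v $ (j - n0))) (k + n0)"
proof -
  let ?x = "\<lambda>j. if j < n0 then 0 else v $ (j - n0)"
  let ?h = "\<lambda>j. \<Sum>m\<le>min (k + n0) j. b (k + n0 - m) * cnj (b (j - m))"
  have "(A *\<^sub>v v) $ k = (\<Sum>i\<le>N. A $$ (k, i) * v $ i)"
    using A v k
    by (auto simp: scalar_prod_def lessThan_Suc_atMost[symmetric] lessThan_atLeast0 simp del: sum.op_ivl_Suc)
  also have "\<dots> = (\<Sum>i\<le>N. c * (?h (i + n0) * v $ i))"
    using k by (intro sum.cong) (auto simp: entry)
  also have "\<dots> = c * (\<Sum>i\<le>N. ?h (i + n0) * v $ i)"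
    by (simp add: sum_distrib_left)
  also have "(\<Sum>i\<le>N. ?h (i + n0) * v $ i) = (\<Sum>j=n0..N+n0. ?h j * ?x j)"
    by (intro sum.reindex_bij_witness[of _ "\<lambda>j. j - n0" "\<lambda>i. i + n0"]) auto
  also have "\<dots> = (\<Sum>j\<le>N+n0. ?h j * ?x j)"
    by (intro sum.mono_neutral_left) auto
  also have "\<dots> = lower_act b (upper_act b (N + n0) ?x) (k + n0)"
    using k by (subst lower_upper_act) auto
  finally show ?thesis .
qed

section \<open>Invertibility, and entries of the inverse\<close>

text \<open>A kernel vector has zero energy, so the adjoint of \<open>L\<close> annihilates its
  padding; that triangular operator is injective, hence the vector is zero.\<close>

lemma (in convolution_inverse) invertible_mat_factorized:
  assumes A: "A \<in> carrier_mat (N + 1) (N + 1)" and c: "c \<noteq> 0"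
    and entry: "\<And>k l. k \<le> N \<Longrightarrow> l \<le> N \<Longrightarrow> A $$ (k, l) =
       c * (\<Sum>m\<le>min (k + n0) (l + n0). b (k + n0 - m) * cnj (b (l + n0 - m)))"
  shows "invertible_mat A"
proof -
  have "v = 0\<^sub>v (N + 1)" if v: "v \<in> carrier_vec (N + 1)" and Av: "A *\<^sub>v v = 0\<^sub>v (N + 1)" for v
  proof -
    let ?x = "\<lambda>j. if j < n0 then 0 else v $ (j - n0)"
    let ?Y = "upper_act b (N + n0) ?x"
    have "lower_act b ?Y (i + n0) = 0" if "i \<le> N" for i
      using mult_mat_vec_eq_lower_upper_act[OF A v that entry] Av that c by simp
    hence "lower_act b ?Y j = 0" if "n0 \<le> j" "j \<le> N + n0" for j
      using that by (metis le_add_diff_inverse2 le_diff_conv)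
    hence "(\<Sum>j\<le>N+n0. cnj (?x j) * lower_act b ?Y j) = 0"
      by (intro sum.neutral) auto
    hence "(\<Sum>m\<le>N+n0. (norm (?Y m))\<^sup>2) = 0"
      unfolding upper_act_energy of_real_eq_0_iff .
    hence Y0: "?Y m = 0" if "m \<le> N + n0" for m
      using that by (subst (asm) sum_nonneg_eq_0_iff) auto
    have "v $ i = 0" if "i \<le> N" for i
      using upper_act_inverse[of "i + n0" "N + n0" ?x] that by (simp add: Y0)
    thus ?thesis using v by (intro eq_vecI) auto
  qed
  hence "det A \<noteq> 0"
    using det_0_iff_vec_prod_zero[OF A] by blast
  from det_non_zero_imp_unit[OF A this, of "()"]
  obtain B where "B \<in> carrier_mat (N + 1) (N + 1)" "B * A = 1\<^sub>m (N + 1)" "A * B = 1\<^sub>m (N + 1)"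
    unfolding Units_def ring_mat_def by auto
  thus ?thesis
    using A unfolding invertible_mat_def inverts_mat_def by auto
qed

text \<open>\<open>inverts_mat\<close> does not prescribe the shape of the chosen inverse: the
  column counts in the two product identities determine it.\<close>

lemma mat_inv_props:
  assumes A: "A \<in> carrier_mat n n" and inv: "invertible_mat A"
  shows "mat_inv A \<in> carrier_mat n n" and "A * mat_inv A = 1\<^sub>m n"
proof -
  have "inverts_mat A (mat_inv A) \<and> inverts_mat (mat_inv A) A"
    unfolding mat_inv_def using inv unfolding invertible_mat_def by (metis (no_types, lifting) someI_ex)
  hence 1: "A * mat_inv A = 1\<^sub>m n" and 2: "mat_inv A * A = 1\<^sub>m (dim_row (mat_inv A))"
    using A by (auto simp: inverts_mat_def)
  have "dim_col (mat_inv A) = n"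
    using arg_cong[OF 1, of dim_col] by simp
  moreover have "dim_row (mat_inv A) = n"
    using arg_cong[OF 2, of dim_col] A by simp
  ultimately show "mat_inv A \<in> carrier_mat n n" by auto
  show "A * mat_inv A = 1\<^sub>m n" by (rule 1)
qed

text \<open>The conjugate transpose of \<open>B\<close> is a left inverse of \<open>A\<close>, hence
  equals the right inverse \<open>B\<close>.\<close>

lemma hermitian_inverse_entry:
  fixes A B :: "complex mat"
  assumes A: "A \<in> carrier_mat n n" and B: "B \<in> carrier_mat n n"
    and AB: "A * B = 1\<^sub>m n"
    and herm: "\<And>i j. i < n \<Longrightarrow> j < n \<Longrightarrow> A $$ (i, j) = cnj (A $$ (j, i))"
    and kl: "k < n" "l < n"
  shows "B $$ (k, l) = cnj (B $$ (l, k))"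
proof -
  define B' where "B' = mat n n (\<lambda>(i, j). cnj (B $$ (j, i)))"
  have B': "B' \<in> carrier_mat n n" by (simp add: B'_def)
  have "B' * A = 1\<^sub>m n"
  proof (rule eq_matI)
    fix i j assume "i < dim_row (1\<^sub>m n :: complex mat)" "j < dim_col (1\<^sub>m n :: complex mat)"
    hence ij: "i < n" "j < n" by auto
    have "(B' * A) $$ (i, j) = (\<Sum>m<n. cnj (B $$ (m, i)) * A $$ (m, j))"
      using ij A B' by (auto simp: scalar_prod_def B'_def lessThan_atLeast0 intro!: sum.cong)
    also have "\<dots> = (\<Sum>m<n. cnj (A $$ (j, m) * B $$ (m, i)))"
      using ij herm[of _ j] by (intro sum.cong) (auto simp: mult.commute)
    also have "\<dots> = cnj ((A * B) $$ (j, i))"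
      using ij A B by (auto simp: scalar_prod_def lessThan_atLeast0 intro!: sum.cong)
    also have "\<dots> = 1\<^sub>m n $$ (i, j)"
      using ij by (simp add: AB)
    finally show "(B' * A) $$ (i, j) = 1\<^sub>m n $$ (i, j)" .
  qed (use A B' in auto)
  hence "B' = B"
    using assoc_mult_mat[OF B' A B] AB B B' by simp
  thus ?thesis using kl by (auto simp: B'_def dest: arg_cong[where f = "\<lambda>M. M $$ (k, l)"])
qed

text \<open>Column \<open>l\<close> of the inverse solves the system with the \<open>l\<close>-th
  unit vector on the right. Padding shifts both indices by \<open>n0\<close> and keeps
  \<open>k - l\<close>; \<open>D\<close> serves all sizes at once.\<close>

lemma (in convolution_inverse) mat_inv_entry_decay:
  assumes g: "\<And>n. norm (g n) \<le> C * r ^ n" and r: "0 < r" "r < 1" and c: "c \<noteq> 0"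
  shows "\<exists>D. \<forall>N A k l. A \<in> carrier_mat (N + 1) (N + 1) \<longrightarrow>
     (\<forall>k\<le>N. \<forall>l\<le>N. A $$ (k, l) =
        c * (\<Sum>m\<le>min (k + n0) (l + n0). b (k + n0 - m) * cnj (b (l + n0 - m)))) \<longrightarrow>
     l \<le> k \<longrightarrow> k \<le> N \<longrightarrow> norm (mat_inv A $$ (k, l)) \<le> D * r ^ (k - l)"
proof -
  obtain D where D: "\<And>M x l k. (\<forall>j<n0. x j = 0) \<Longrightarrow> n0 \<le> l \<Longrightarrow> l \<le> k \<Longrightarrow> k \<le> M \<Longrightarrow>
     (\<forall>j\<in>{n0..M}. c * lower_act b (upper_act b M x) j = (if j = l then 1 else 0)) \<Longrightarrow>
     norm (x k) \<le> D * r ^ (k - l)"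
    using unit_solution_decay[OF g r c, of n0] by blast
  have "norm (mat_inv A $$ (k, l)) \<le> D * r ^ (k - l)"
    if A: "A \<in> carrier_mat (N + 1) (N + 1)" and entry: "\<forall>k\<le>N. \<forall>l\<le>N. A $$ (k, l) =
        c * (\<Sum>m\<le>min (k + n0) (l + n0). b (k + n0 - m) * cnj (b (l + n0 - m)))"
      and kl: "l \<le> k" "k \<le> N" for N A k l
  proof -
    have "invertible_mat A"
      by (rule invertible_mat_factorized[OF A c]) (use entry in blast)
    note inv = mat_inv_props[OF A this]
    define v where "v = col (mat_inv A) l"
    have v: "v \<in> carrier_vec (N + 1)"
      using inv(1) unfolding v_def by (metis carrier_matD(1) col_carrier_vec col_dim)
    define x where "x = (\<lambda>j. if j < n0 then 0 else v $ (j - n0))"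
    have "A *\<^sub>v v = col (A * mat_inv A) l"
      unfolding v_def using A inv(1) kl by (subst col_mult2[of _ "N + 1" "N + 1" _ "N + 1"]) auto
    also have "\<dots> = unit_vec (N + 1) l"
      using kl by (simp add: inv(2))
    finally have Av: "A *\<^sub>v v = unit_vec (N + 1) l" .
    have "c * lower_act b (upper_act b (N + n0) x) (i + n0) = (if i = l then 1 else 0)"
      if "i \<le> N" for i
      using mult_mat_vec_eq_lower_upper_act[OF A v that, of c b n0] entry that kl
      by (simp add: Av x_def)
    hence "\<forall>j\<in>{n0..N + n0}. c * lower_act b (upper_act b (N + n0) x) j = (if j = l + n0 then 1 else 0)"
      by (metis add_diff_cancel_right' atLeastAtMost_iff le_add_diff_inverse2 le_diff_conv)
    from D[OF _ _ _ _ this, of "k + n0"] kl have "norm (x (k + n0)) \<le> D * r ^ (k - l)"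
      by (simp add: x_def)
    moreover have "x (k + n0) = mat_inv A $$ (k, l)"
      using inv(1) kl by (simp add: x_def v_def)
    ultimately show ?thesis by simp
  qed
  thus ?thesis by blast
qed

lemma toeplitz_band_carrier: "toeplitz_band a n0 N \<in> carrier_mat (N + 1) (N + 1)"
  by (simp add: toeplitz_band_def)

lemma toeplitz_band_hermitian:
  assumes "\<And>j. \<bar>j\<bar> \<le> int n0 \<Longrightarrow> a j = cnj (a (- j))" and "i < N + 1" "j < N + 1"
  shows "toeplitz_band a n0 N $$ (i, j) = cnj (toeplitz_band a n0 N $$ (j, i))"
  using assms(1)[of "int i - int j"] assms(2,3) by (auto simp: toeplitz_band_def abs_minus_commute)

section \<open>From geometric decay to the asymptotic statement\<close>

lemma smallo_of_geometric_decay: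
  fixes f :: "nat \<Rightarrow> complex" and d :: "nat \<Rightarrow> nat" and x \<rho> c D :: real
  assumes \<rho>: "0 < \<rho>" "\<rho> < 1" and c: "c < 1" and x: "0 < x"
    and d: "\<And>N. N \<in> S \<Longrightarrow> real (d N) = real N * x"
    and f: "\<And>N. N \<in> S \<Longrightarrow> norm (f N) \<le> D * \<rho> ^ d N"
  shows "f \<in> o[inf at_top (principal S)](\<lambda>N. complex_of_real (\<rho> powr (c * real (d N))))"
proof (rule landau_o.smallI)
  fix e :: real assume e: "0 < e"
  \<comment> \<open>As \<open>d N = N * x\<close>, the surplus factor
    \<open>\<rho> powr ((1 - c) * d N)\<close> equals \<open>q ^ N\<close>, which tends to
    0.\<close>
  define q where "q = \<rho> powr ((1 - c) * x)"
  have q: "0 < q" "q < 1"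
    using \<rho> c x powr_less_mono2[of "(1 - c) * x" \<rho> 1] by (auto simp: q_def)
  have "(\<lambda>N. \<bar>D\<bar> * q ^ N) \<longlonglongrightarrow> \<bar>D\<bar> * 0"
    using q by (intro tendsto_mult_left LIMSEQ_power_zero) auto
  hence "eventually (\<lambda>N. \<bar>D\<bar> * q ^ N < e) at_top"
    using e by (intro order_tendstoD) auto
  thus "eventually (\<lambda>N. norm (f N) \<le> e * norm (complex_of_real (\<rho> powr (c * real (d N)))))
          (inf at_top (principal S))"
    unfolding eventually_inf_principal
  proof eventually_elim
    case (elim N)
    show ?case
    proof
      assume N: "N \<in> S"
      have qN: "\<rho> ^ d N = q ^ N * \<rho> powr (c * real (d N))"
      proof -
        have "q ^ N = \<rho> powr ((1 - c) * x * real N)"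
          using \<rho> by (simp add: q_def powr_realpow[symmetric] powr_powr)
        also have "(1 - c) * x * real N = (1 - c) * real (d N)"
          using d[OF N] by simp
        finally show ?thesis
          using \<rho> by (simp add: powr_add[symmetric] powr_realpow[symmetric] algebra_simps)
      qed
      have "norm (f N) \<le> D * \<rho> ^ d N" by (rule f[OF N])
      also have "\<dots> \<le> \<bar>D\<bar> * \<rho> ^ d N"
        using \<rho> by (intro mult_right_mono) auto
      also have "\<dots> = (\<bar>D\<bar> * q ^ N) * \<rho> powr (c * real (d N))"
        by (simp add: qN)
      also have "\<dots> \<le> e * \<rho> powr (c * real (d N))"
        using elim by (intro mult_right_mono) auto
      finally show "norm (f N) \<le> e * norm (complex_of_real (\<rho> powr (c * real (d N))))"
        by simp
    qed
  qed
qed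

text \<open>The exponent factor is called \<open>c\<close>, since \<open>a\<close> names the
  coefficients. The filter keeps only those \<open>N\<close> with \<open>N * x\<close> integral, as
  otherwise no indices at distance \<open>N * x\<close> exist.\<close>

theorem mainTheorem2:
  fixes n0 :: nat and a :: "int \<Rightarrow> complex"
  assumes n0: "n0 \<ge> 1"
    and herm: "\<And>j. \<bar>j\<bar> \<le> int n0 \<Longrightarrow> a j = cnj (a (- j))"
    and no_unit_root: "\<And>z. poly (K_poly a n0) z = 0 \<Longrightarrow> norm z \<noteq> 1"
    and inside: "roots_count_in (K_poly a n0) {z. norm z < 1} = n0"
    and outside: "roots_count_in (K_poly a n0) {z. norm z > 1} = n0"
    and monic: "lead_coeff (K_poly a n0) = 1"
  shows "(\<forall>N\<ge>1. invertible_mat (toeplitz_band a n0 N)) \<and>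
    (\<forall>(x::real) (k::nat \<Rightarrow> nat) (l::nat \<Rightarrow> nat) (c::real) (\<rho>::real).
       0 < x \<and> x < 1 \<and>
       (\<forall>N. real N * x \<in> \<int> \<longrightarrow>
           k N \<le> N \<and> l N \<le> N \<and> \<bar>real (k N) - real (l N)\<bar> = real N * x) \<and>
       0 < c \<and> c < 1 \<and>
       Max (norm ` {z. poly (K_poly a n0) z = 0 \<and> norm z < 1}) < \<rho> \<and> \<rho> < 1
     \<longrightarrow> (\<lambda>N. mat_inv (toeplitz_band a n0 N) $$ (k N, l N))
           \<in> o[inf at_top (principal {N. real N * x \<in> \<int>})](\<lambda>N. complex_of_real (\<rho> powr (c * \<bar>real (k N) - real (l N)\<bar>))))"
proof -
  define K where "K = K_poly a n0"
  define A where "A = {z. poly K z = 0 \<and> norm z < 1}"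
  define Q where "Q = (\<Prod>z\<in>A. [:-z, 1:] ^ order z K)"
  define P where "P = (\<Prod>z\<in>A. [:1, -cnj z:] ^ order z K)"
  define b where "b = coeff P"
  note fact = K_poly_spectral_factorization[OF herm no_unit_root inside outside monic,
      folded K_def, folded A_def, folded Q_def P_def]
  obtain \<kappa> where \<kappa>: "\<kappa> \<noteq> 0" "K = smult \<kappa> (P * Q)"
    using fact(4) by blast
  let ?T = "toeplitz_band a n0"
  have entry: "?T N $$ (k, l) =
       \<kappa> * (\<Sum>m\<le>min (k + n0) (l + n0). b (k + n0 - m) * cnj (b (l + n0 - m)))"
    if "k \<le> N" "l \<le> N" for N k l
    using toeplitz_band_factorization[OF \<kappa>(2)[unfolded K_def] fact(1,2,3) that]
    by (simp add: b_def)
  have "K \<noteq> 0" using monic by (auto simp: K_def)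
  hence finA: "finite A"
    using poly_roots_finite[of K] by (auto simp: A_def)
  have conv: "\<exists>g C. convolution_inverse b g \<and> (\<forall>n. norm (g n) \<le> C * r ^ n)"
    if r: "0 < r" "\<And>z. z \<in> A \<Longrightarrow> norm z < r" for r
  proof -
    obtain G C where G: "fps_of_poly P * G = 1" "\<forall>n. norm (fps_nth G n) \<le> C * r ^ n"
      using fps_inverse_prod_linear_bound[OF finA r, of "\<lambda>z. order z K"] unfolding P_def by blast
    have "convolution_inverse b (fps_nth G)"
    proof
      fix n
      have "(\<Sum>i\<le>n. b (n - i) * fps_nth G i) = fps_nth (G * fps_of_poly P) n"
        by (simp add: fps_mult_nth b_def atMost_atLeast0 mult.commute)
      also have "\<dots> = fps_nth 1 n"
        using G(1) by (simp add: mult.commute)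
      finally show "(\<Sum>i\<le>n. b (n - i) * fps_nth G i) = (if n = 0 then 1 else 0)"
        by simp
    qed
    thus ?thesis using G(2) by blast
  qed
  \<comment> \<open>All inner roots have modulus below 1, so \<open>r = 1\<close> is admissible;
    invertibility uses only the algebraic identity, not a rate.\<close>
  obtain g where "convolution_inverse b g"
    using conv[of 1] by (auto simp: A_def)
  then interpret ci: convolution_inverse b g .
  have inv: "invertible_mat (?T N)" for N
    by (rule ci.invertible_mat_factorized[OF toeplitz_band_carrier \<kappa>(1) entry])
  have "(\<lambda>N. mat_inv (?T N) $$ (k N, l N))
      \<in> o[inf at_top (principal {N. real N * x \<in> \<int>})](\<lambda>N. complex_of_real (\<rho> powr (c * \<bar>real (k N) - real (l N)\<bar>)))"
    if x: "0 < x"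
      and kl: "\<And>N. real N * x \<in> \<int> \<Longrightarrow> k N \<le> N \<and> l N \<le> N \<and> \<bar>real (k N) - real (l N)\<bar> = real N * x"
      and c: "c < 1" and \<rho>: "Max (norm ` A) < \<rho>" "\<rho> < 1"
    for x c \<rho> :: real and k l :: "nat \<Rightarrow> nat"
  proof -
    have lt: "norm z < \<rho>" if "z \<in> A" for z
      using Max_ge[of "norm ` A" "norm z"] finA that \<rho>(1) by (meson finite_imageI imageI order_le_less_trans)
    \<comment> \<open>Since \<open>n0 \<ge> 1\<close>, there is an inner root, which forces
      \<open>\<rho>\<close> to be positive.\<close>
    have "(\<Sum>z\<in>A. order z K) = n0"
      using inside by (simp add: A_def K_def roots_count_in_def)
    hence "A \<noteq> {}" using n0 by auto
    then obtain z where "z \<in> A" by blast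
    hence \<rho>0: "0 < \<rho>" using lt[of z] norm_ge_zero[of z] by linarith
    obtain g C where "convolution_inverse b g" and g: "\<And>n. norm (g n) \<le> C * \<rho> ^ n"
      using conv[OF \<rho>0 lt] by blast
    then interpret cj: convolution_inverse b g by simp
    obtain D where D: "\<And>N k l. l \<le> k \<Longrightarrow> k \<le> N \<Longrightarrow> norm (mat_inv (?T N) $$ (k, l)) \<le> D * \<rho> ^ (k - l)"
      using cj.mat_inv_entry_decay[OF g \<rho>0 \<rho>(2) \<kappa>(1), of n0] entry toeplitz_band_carrier by meson
    define d where "d N = nat \<bar>int (k N) - int (l N)\<bar>" for N
    have d: "real (d N) = \<bar>real (k N) - real (l N)\<bar>" for N
      by (simp add: d_def)
    have bound: "norm (mat_inv (?T N) $$ (k N, l N)) \<le> D * \<rho> ^ d N" if "real N * x \<in> \<int>" for N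
    proof (cases "l N \<le> k N")
      case True
      thus ?thesis using D[of "l N" "k N" N] kl[OF that] by (simp add: d_def nat_diff_distrib)
    next
      case False
      note inv_props = mat_inv_props[OF toeplitz_band_carrier inv]
      \<comment> \<open>The decay estimate covers entries on and below the diagonal; Hermitian
        symmetry transfers it above.\<close>
      have "mat_inv (?T N) $$ (k N, l N) = cnj (mat_inv (?T N) $$ (l N, k N))"
        using kl[OF that]
        by (intro hermitian_inverse_entry[OF toeplitz_band_carrier inv_props(1,2)]
              toeplitz_band_hermitian herm) auto
      moreover have "d N = l N - k N" using False by (simp add: d_def)
      ultimately show ?thesis using D[of "k N" "l N" N] kl[OF that] False by simp
    qed
    show ?thesis
      unfolding d[symmetric]
      by (rule smallo_of_geometric_decay[OF \<rho>0 \<rho>(2) c x]) (use kl d bound in auto)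
  qed
  thus ?thesis
    using inv unfolding A_def K_def by blast
qed

end
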